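(* Let $C$ be a Reedy category, let $\Gamma$ be one of $\int N(C)$, $\int N^{-,+}(C)$, $\int N^{--,+}_+(C)$, and let $(\alpha,\theta)\colon([m],X)\to([n],Y)$ be a morphism in $\Gamma$. Then the upward interval $\{(\beta,\varphi)\in\mathrm{Hom}_\Gamma(([m],X),([n],Y)):(\alpha,\theta)\le(\beta,\varphi)\}$, with the induced order, is a bounded distributive lattice.
   Context: A Reedy category $(C,C_-,C_+)$: wide subcategories with unique factorization of every morphism as ($C_-$ then $C_+$), membership in $C_\pm$ decidable, and the relation ($x<'y$ iff non-identity $x\to y$ in $C_+$ or non-identity $y\to x$ in $C_-$) well-founded. $\Delta$: finite ordinals $[n]$ and order-preserving maps. $\int N(C)$: objects $([n],X)$ with $X\colon[n]\to C$ a functor; morphisms $([m],X)\to([n],Y)$ are $(\alpha,\theta)$, $\alpha\colon[m]\to[n]$ in $\Delta$, $\theta\colon X\Rightarrow Y\circ\alpha$; composition $(\beta,\varphi)\circ(\alpha,\theta)=(\beta\alpha,(\varphi\alpha)\circ\theta)$. $\int N^{-,+}(C)$: subcategory of objects with $X$ sending all morphisms into $C_-$ and morphisms with all $\theta_i\in C_+$. $\int N^{--,+}_+(C)$: its subcategory of objects whose $X$ reflects identities and morphisms with $\alpha$ injective. Order on hom-sets: $(\alpha,\theta)\le(\alpha',\theta')$ iff $\alpha\le\alpha'$ pointwise and $\theta'_i=Y(\alpha(i)\le\alpha'(i))\circ\theta_i$ for all $i$. *)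

theory Defs
  imports Main
begin

record ('o, 'm) cat =
  Ob  :: "'o set"
  Ar  :: "'m set"
  Dom :: "'m \<Rightarrow> 'o"
  Cod :: "'m \<Rightarrow> 'o"
  Comp :: "'m \<Rightarrow> 'm \<Rightarrow> 'm"   (* Comp C g f = g \<circ> f *)
  Idm :: "'o \<Rightarrow> 'm"

definition hom :: "('o, 'm) cat \<Rightarrow> 'o \<Rightarrow> 'o \<Rightarrow> 'm set" where
  "hom C a b = {f \<in> Ar C. Dom C f = a \<and> Cod C f = b}"

definition category :: "('o, 'm) cat \<Rightarrow> bool" where
  "category C \<longleftrightarrow>
     (\<forall>f\<in>Ar C. Dom C f \<in> Ob C \<and> Cod C f \<in> Ob C) \<and>
     (\<forall>a\<in>Ob C. Idm C a \<in> hom C a a) \<and>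
     (\<forall>f\<in>Ar C. \<forall>g\<in>Ar C. Cod C f = Dom C g \<longrightarrow>
         Comp C g f \<in> hom C (Dom C f) (Cod C g)) \<and>
     (\<forall>f\<in>Ar C. Comp C (Idm C (Cod C f)) f = f \<and> Comp C f (Idm C (Dom C f)) = f) \<and>
     (\<forall>f\<in>Ar C. \<forall>g\<in>Ar C. \<forall>h\<in>Ar C. Cod C f = Dom C g \<longrightarrow> Cod C g = Dom C h \<longrightarrow>
         Comp C h (Comp C g f) = Comp C (Comp C h g) f)"

definition wide_subcat :: "('o, 'm) cat \<Rightarrow> 'm set \<Rightarrow> bool" where
  "wide_subcat C S \<longleftrightarrow> S \<subseteq> Ar C \<and> (\<forall>a\<in>Ob C. Idm C a \<in> S) \<and>
     (\<forall>f\<in>S. \<forall>g\<in>S. Cod C f = Dom C g \<longrightarrow> Comp C g f \<in> S)"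

definition reedy_rel :: "('o, 'm) cat \<Rightarrow> 'm set \<Rightarrow> 'm set \<Rightarrow> ('o \<times> 'o) set" where
  "reedy_rel C Cm Cp = {(x, y). x \<in> Ob C \<and> y \<in> Ob C \<and>
     ((\<exists>f \<in> hom C x y \<inter> Cp. f \<noteq> Idm C x) \<or> (\<exists>f \<in> hom C y x \<inter> Cm. f \<noteq> Idm C y))}"

definition reedy :: "('o, 'm) cat \<Rightarrow> 'm set \<Rightarrow> 'm set \<Rightarrow> bool" where
  "reedy C Cm Cp \<longleftrightarrow> category C \<and> wide_subcat C Cm \<and> wide_subcat C Cp \<and>
     (\<forall>f\<in>Ar C. \<exists>!(p, q). q \<in> Cm \<and> p \<in> Cp \<and> Cod C q = Dom C p \<and> Comp C p q = f) \<and>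
     wf (reedy_rel C Cm Cp)"

text \<open>An object ([n],X): n, the object part Xo and the arrow part Xa, where
  Xa i j is X(i \<le> j).\<close>
type_synonym ('o, 'm) nobj = "nat \<times> (nat \<Rightarrow> 'o) \<times> (nat \<Rightarrow> nat \<Rightarrow> 'm)"

text \<open>A morphism (\<alpha>, \<theta>); components are extensional (undefined beyond the source length).\<close>
type_synonym 'm nmor = "(nat \<Rightarrow> nat) \<times> (nat \<Rightarrow> 'm)"

definition nat_functor :: "('o, 'm) cat \<Rightarrow> ('o, 'm) nobj \<Rightarrow> bool" where
  "nat_functor C x = (case x of (n, Xo, Xa) \<Rightarrow>
     (\<forall>i\<le>n. Xo i \<in> Ob C) \<and>
     (\<forall>i j. i \<le> j \<and> j \<le> n \<longrightarrow> Xa i j \<in> hom C (Xo i) (Xo j)) \<and>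
     (\<forall>i\<le>n. Xa i i = Idm C (Xo i)) \<and>
     (\<forall>i j k. i \<le> j \<and> j \<le> k \<and> k \<le> n \<longrightarrow> Comp C (Xa j k) (Xa i j) = Xa i k))"

datatype variant = Full | MinusPlus | MinusMinusPlusPlus

text \<open>Objects of \<open>\<integral>N(C)\<close> (Full), \<open>\<integral>N^{-,+}(C)\<close> (MinusPlus), \<open>\<integral>N^{--,+}_+(C)\<close> (MinusMinusPlusPlus).\<close>
definition gobj :: "variant \<Rightarrow> ('o, 'm) cat \<Rightarrow> 'm set \<Rightarrow> 'm set \<Rightarrow> ('o, 'm) nobj \<Rightarrow> bool" where
  "gobj v C Cm Cp x = (case x of (n, Xo, Xa) \<Rightarrow>
     nat_functor C x \<and>
     (v \<noteq> Full \<longrightarrow> (\<forall>i j. i \<le> j \<and> j \<le> n \<longrightarrow> Xa i j \<in> Cm)) \<and>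
     (v = MinusMinusPlusPlus \<longrightarrow> (\<forall>i j. i \<le> j \<and> j \<le> n \<and> Xa i j = Idm C (Xo i) \<longrightarrow> i = j)))"

definition nmor_full :: "('o, 'm) cat \<Rightarrow> ('o, 'm) nobj \<Rightarrow> ('o, 'm) nobj \<Rightarrow> 'm nmor set" where
  "nmor_full C x y = (case x of (m, Xo, Xa) \<Rightarrow> case y of (n, Yo, Ya) \<Rightarrow>
     {(\<alpha>, \<theta>).
       (\<forall>i\<le>m. \<alpha> i \<le> n) \<and>
       (\<forall>i j. i \<le> j \<and> j \<le> m \<longrightarrow> \<alpha> i \<le> \<alpha> j) \<and>
       (\<forall>i\<le>m. \<theta> i \<in> hom C (Xo i) (Yo (\<alpha> i))) \<and>
       (\<forall>i j. i \<le> j \<and> j \<le> m \<longrightarrow> Comp C (\<theta> j) (Xa i j) = Comp C (Ya (\<alpha> i) (\<alpha> j)) (\<theta> i)) \<and>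
       (\<forall>i. m < i \<longrightarrow> \<alpha> i = undefined \<and> \<theta> i = undefined)})"

definition ghom :: "variant \<Rightarrow> ('o, 'm) cat \<Rightarrow> 'm set \<Rightarrow> 'm set \<Rightarrow>
    ('o, 'm) nobj \<Rightarrow> ('o, 'm) nobj \<Rightarrow> 'm nmor set" where
  "ghom v C Cm Cp x y = {(\<alpha>, \<theta>) \<in> nmor_full C x y.
     (v \<noteq> Full \<longrightarrow> (\<forall>i\<le>fst x. \<theta> i \<in> Cp)) \<and>
     (v = MinusMinusPlusPlus \<longrightarrow> inj_on \<alpha> {..fst x})}"

definition nmor_le :: "('o, 'm) cat \<Rightarrow> ('o, 'm) nobj \<Rightarrow> ('o, 'm) nobj \<Rightarrow> 'm nmor \<Rightarrow> 'm nmor \<Rightarrow> bool" where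
  "nmor_le C x y f g = (case f of (\<alpha>, \<theta>) \<Rightarrow> case g of (\<alpha>', \<theta>') \<Rightarrow>
     (\<forall>i\<le>fst x. \<alpha> i \<le> \<alpha>' i \<and> \<theta>' i = Comp C (snd (snd y) (\<alpha> i) (\<alpha>' i)) (\<theta> i)))"

definition is_lub :: "'a set \<Rightarrow> ('a \<Rightarrow> 'a \<Rightarrow> bool) \<Rightarrow> 'a \<Rightarrow> 'a \<Rightarrow> 'a \<Rightarrow> bool" where
  "is_lub S le a b s \<longleftrightarrow> s \<in> S \<and> le a s \<and> le b s \<and> (\<forall>u\<in>S. le a u \<and> le b u \<longrightarrow> le s u)"

definition is_glb :: "'a set \<Rightarrow> ('a \<Rightarrow> 'a \<Rightarrow> bool) \<Rightarrow> 'a \<Rightarrow> 'a \<Rightarrow> 'a \<Rightarrow> bool" where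
  "is_glb S le a b s \<longleftrightarrow> s \<in> S \<and> le s a \<and> le s b \<and> (\<forall>u\<in>S. le u a \<and> le u b \<longrightarrow> le u s)"

definition bounded_distrib_lattice_on :: "'a set \<Rightarrow> ('a \<Rightarrow> 'a \<Rightarrow> bool) \<Rightarrow> bool" where
  "bounded_distrib_lattice_on S le \<longleftrightarrow>
     (\<forall>a\<in>S. le a a) \<and>
     (\<forall>a\<in>S. \<forall>b\<in>S. le a b \<and> le b a \<longrightarrow> a = b) \<and>
     (\<forall>a\<in>S. \<forall>b\<in>S. \<forall>c\<in>S. le a b \<and> le b c \<longrightarrow> le a c) \<and>
     (\<exists>join meet.
        (\<forall>a\<in>S. \<forall>b\<in>S. is_lub S le a b (join a b) \<and> is_glb S le a b (meet a b)) \<and>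
        (\<forall>a\<in>S. \<forall>b\<in>S. \<forall>c\<in>S. meet a (join b c) = join (meet a b) (meet a c))) \<and>
     (\<exists>t\<in>S. \<forall>a\<in>S. le a t) \<and>
     (\<exists>z\<in>S. \<forall>a\<in>S. le z a)"

end

theory Submission
  imports Defs "HOL-Library.FuncSet"
begin

(* A morphism (beta, phi) above f = (alpha, theta) is determined by beta: the order forces
   phi_i = Y(alpha_i <= beta_i) o theta_i, and conversely this phi is natural for every monotone
   beta >= alpha, by naturality of theta and functoriality of Y.  So the interval is
   order-isomorphic, via beta, to a set of maps [m] -> [n] under the pointwise order.  The
   constraints cutting out this set (alpha <= beta, monotonicity, injectivity for the third
   variant, phi_i in C_+ for the last two) survive pointwise max and min -- the C_+ condition
   because max and min agree at each i with one of their arguments -- so the set is a finite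
   nonempty sublattice of the distributive lattice nat => nat. *)

lemma Sup_fin_mem_sup_closed:
  fixes A B :: "'a::lattice set"
  assumes "finite A" "A \<noteq> {}" "A \<subseteq> B" and sup_closed: "\<And>a b. a \<in> B \<Longrightarrow> b \<in> B \<Longrightarrow> sup a b \<in> B"
  shows "Sup_fin A \<in> B"
  using assms(1-3) by (induction rule: finite_ne_induct) (auto simp: sup_closed)

lemma Inf_fin_mem_inf_closed:
  fixes A B :: "'a::lattice set"
  assumes "finite A" "A \<noteq> {}" "A \<subseteq> B" and inf_closed: "\<And>a b. a \<in> B \<Longrightarrow> b \<in> B \<Longrightarrow> inf a b \<in> B"
  shows "Inf_fin A \<in> B"
  using assms(1-3) by (induction rule: finite_ne_induct) (auto simp: inf_closed)

lemma bounded_distrib_lattice_on_finite_sublattice: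
  fixes B :: "'a::distrib_lattice set"
  assumes "finite B" "B \<noteq> {}"
    and sup_closed: "\<And>a b. a \<in> B \<Longrightarrow> b \<in> B \<Longrightarrow> sup a b \<in> B"
    and inf_closed: "\<And>a b. a \<in> B \<Longrightarrow> b \<in> B \<Longrightarrow> inf a b \<in> B"
  shows "bounded_distrib_lattice_on B (\<le>)"
proof -
  have "\<forall>a\<in>B. \<forall>b\<in>B. is_lub B (\<le>) a b (sup a b) \<and> is_glb B (\<le>) a b (inf a b)"
    by (simp add: is_lub_def is_glb_def sup_closed inf_closed)
  moreover have "\<forall>a\<in>B. \<forall>b\<in>B. \<forall>c\<in>B. inf a (sup b c) = sup (inf a b) (inf a c)"
    by (simp add: inf_sup_distrib1)
  moreover have "Sup_fin B \<in> B" "Inf_fin B \<in> B"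
    using assms by (auto intro: Sup_fin_mem_sup_closed Inf_fin_mem_inf_closed)
  moreover have "\<forall>a\<in>B. a \<le> Sup_fin B" "\<forall>a\<in>B. Inf_fin B \<le> a"
    using \<open>finite B\<close> by (auto intro: Sup_fin.coboundedI Inf_fin.coboundedI)
  ultimately show ?thesis
    unfolding bounded_distrib_lattice_on_def by (blast intro: order_trans antisym)
qed

lemma bounded_distrib_lattice_on_image:
  assumes L: "bounded_distrib_lattice_on B le"
    and emb: "\<And>a b. a \<in> B \<Longrightarrow> b \<in> B \<Longrightarrow> le' (h a) (h b) \<longleftrightarrow> le a b"
  shows "bounded_distrib_lattice_on (h ` B) le'"
proof -
  obtain t z where le_refl: "\<forall>a\<in>B. le a a"
    and le_antisym: "\<forall>a\<in>B. \<forall>b\<in>B. le a b \<and> le b a \<longrightarrow> a = b"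
    and le_trans: "\<forall>a\<in>B. \<forall>b\<in>B. \<forall>c\<in>B. le a b \<and> le b c \<longrightarrow> le a c"
    and t: "t \<in> B" "\<forall>a\<in>B. le a t" and z: "z \<in> B" "\<forall>a\<in>B. le z a"
    using L unfolding bounded_distrib_lattice_on_def by blast
  obtain join meet where
    jm: "\<forall>a\<in>B. \<forall>b\<in>B. is_lub B le a b (join a b) \<and> is_glb B le a b (meet a b)" and
    distrib: "\<forall>a\<in>B. \<forall>b\<in>B. \<forall>c\<in>B. meet a (join b c) = join (meet a b) (meet a c)"
    using L unfolding bounded_distrib_lattice_on_def by blast
  have inj: "inj_on h B"
  proof (rule inj_onI)
    fix a b assume ab: "a \<in> B" "b \<in> B" "h a = h b"
    then have "le a b" "le b a"
      using le_refl emb[of a b] emb[of b b] emb[of b a] emb[of a a] by simp_all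
    then show "a = b" using le_antisym ab by blast
  qed
  define g where "g = inv_into B h"
  have g_h: "g (h a) = a" if "a \<in> B" for a
    using inv_into_f_f[OF inj that] by (simp add: g_def)
  define join' where "join' u v = h (join (g u) (g v))" for u v
  define meet' where "meet' u v = h (meet (g u) (g v))" for u v
  have lub_glb: "\<forall>a\<in>B. \<forall>b\<in>B. is_lub (h ` B) le' (h a) (h b) (join' (h a) (h b)) \<and>
      is_glb (h ` B) le' (h a) (h b) (meet' (h a) (h b))"
    using jm unfolding is_lub_def is_glb_def join'_def meet'_def by (auto simp: g_h emb)
  have distrib': "\<forall>a\<in>B. \<forall>b\<in>B. \<forall>c\<in>B.
      meet' (h a) (join' (h b) (h c)) = join' (meet' (h a) (h b)) (meet' (h a) (h c))"
    using jm distrib unfolding is_lub_def is_glb_def join'_def meet'_def by (simp add: g_h)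
  show ?thesis
    unfolding bounded_distrib_lattice_on_def ball_simps bex_simps
  proof (intro conjI)
    show "\<forall>a\<in>B. le' (h a) (h a)"
      using le_refl by (simp add: emb)
    show "\<forall>a\<in>B. \<forall>b\<in>B. le' (h a) (h b) \<and> le' (h b) (h a) \<longrightarrow> h a = h b"
    proof (intro ballI impI)
      fix a b assume ab: "a \<in> B" "b \<in> B" and "le' (h a) (h b) \<and> le' (h b) (h a)"
      then have "le a b" "le b a" by (simp_all add: emb)
      with ab le_antisym show "h a = h b" by metis
    qed
    show "\<forall>a\<in>B. \<forall>b\<in>B. \<forall>c\<in>B. le' (h a) (h b) \<and> le' (h b) (h c) \<longrightarrow> le' (h a) (h c)"
    proof (intro ballI impI)
      fix a b c assume abc: "a \<in> B" "b \<in> B" "c \<in> B"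
        and "le' (h a) (h b) \<and> le' (h b) (h c)"
      then have "le a b" "le b c" by (simp_all add: emb)
      with abc le_trans have "le a c" by blast
      with abc show "le' (h a) (h c)" by (simp add: emb)
    qed
    show "\<exists>a\<in>B. \<forall>b\<in>B. le' (h b) (h a)"
      using t by (auto simp: emb)
    show "\<exists>a\<in>B. \<forall>b\<in>B. le' (h a) (h b)"
      using z by (auto simp: emb)
  qed (use lub_glb distrib' in blast)
qed

lemma strict_mono_on_max:
  fixes f g :: "'a::order \<Rightarrow> 'b::linorder"
  assumes "strict_mono_on A f" "strict_mono_on A g"
  shows "strict_mono_on A (\<lambda>x. max (f x) (g x))"
proof (rule strict_mono_onI)
  fix r s assume "r \<in> A" "s \<in> A" "r < s"
  then have "f r < f s" "g r < g s" using assms by (auto dest: strict_mono_onD)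
  then show "max (f r) (g r) < max (f s) (g s)" by (auto simp: max_def)
qed

lemma strict_mono_on_min:
  fixes f g :: "'a::order \<Rightarrow> 'b::linorder"
  assumes "strict_mono_on A f" "strict_mono_on A g"
  shows "strict_mono_on A (\<lambda>x. min (f x) (g x))"
proof (rule strict_mono_onI)
  fix r s assume "r \<in> A" "s \<in> A" "r < s"
  then have "f r < f s" "g r < g s" using assms by (auto dest: strict_mono_onD)
  then show "min (f r) (g r) < min (f s) (g s)" by (auto simp: min_def)
qed

lemma cat_comp_hom:
  "category C \<Longrightarrow> f \<in> hom C a b \<Longrightarrow> g \<in> hom C b c \<Longrightarrow> Comp C g f \<in> hom C a c"
  unfolding category_def hom_def by auto

lemma cat_comp_assoc:
  "category C \<Longrightarrow> f \<in> hom C a b \<Longrightarrow> g \<in> hom C b c \<Longrightarrow> h \<in> hom C c d \<Longrightarrow>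
    Comp C h (Comp C g f) = Comp C (Comp C h g) f"
  unfolding category_def hom_def by auto

lemma cat_id_comp:
  "category C \<Longrightarrow> f \<in> hom C a b \<Longrightarrow> Comp C (Idm C b) f = f"
  unfolding category_def hom_def by auto

lemma nat_functor_hom:
  "nat_functor C (n, Yo, Ya) \<Longrightarrow> i \<le> j \<Longrightarrow> j \<le> n \<Longrightarrow> Ya i j \<in> hom C (Yo i) (Yo j)"
  by (simp add: nat_functor_def)

lemma nat_functor_comp_hom:
  assumes "category C" "nat_functor C (n, Yo, Ya)" "a \<le> b" "b \<le> n" "t \<in> hom C z (Yo a)"
  shows "Comp C (Ya a b) t \<in> hom C z (Yo b)"
  using assms by (blast intro: cat_comp_hom nat_functor_hom)

lemma nat_functor_id_comp:
  assumes "category C" "nat_functor C (n, Yo, Ya)" "a \<le> n" "t \<in> hom C z (Yo a)"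
  shows "Comp C (Ya a a) t = t"
  using assms cat_id_comp[of C t z "Yo a"] by (simp add: nat_functor_def)

lemma nat_functor_comp_comp:
  assumes C: "category C" and Y: "nat_functor C (n, Yo, Ya)"
    and "a \<le> b" "b \<le> c" "c \<le> n" and t: "t \<in> hom C z (Yo a)"
  shows "Comp C (Ya b c) (Comp C (Ya a b) t) = Comp C (Ya a c) t"
proof -
  have "Comp C (Ya b c) (Comp C (Ya a b) t) = Comp C (Comp C (Ya b c) (Ya a b)) t"
    using assms by (intro cat_comp_assoc[OF C t]) (auto intro: nat_functor_hom)
  also have "Comp C (Ya b c) (Ya a b) = Ya a c"
    using Y assms(3-5) by (simp add: nat_functor_def)
  finally show ?thesis .
qed

definition nmor_raise ::
    "('o, 'm) cat \<Rightarrow> nat \<Rightarrow> (nat \<Rightarrow> nat \<Rightarrow> 'm) \<Rightarrow> 'm nmor \<Rightarrow> (nat \<Rightarrow> nat) \<Rightarrow> 'm nmor"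
  where "nmor_raise C m Ya f \<beta> =
    (\<beta>, \<lambda>i. if i \<le> m then Comp C (Ya (fst f i) (\<beta> i)) (snd f i) else undefined)"

(* Extensionality ({..m} ->E {..n}, as in nmor_full) makes the pointwise order of nat => nat
   coincide with the order of the interval. *)
definition raisings :: "variant \<Rightarrow> ('o, 'm) cat \<Rightarrow> 'm set \<Rightarrow> nat \<Rightarrow> nat \<Rightarrow> (nat \<Rightarrow> nat \<Rightarrow> 'm) \<Rightarrow>
    'm nmor \<Rightarrow> (nat \<Rightarrow> nat) set"
  where "raisings v C Cp m n Ya f = {\<beta> \<in> {..m} \<rightarrow>\<^sub>E {..n}.
    (\<forall>i\<le>m. fst f i \<le> \<beta> i) \<and> mono_on {..m} \<beta> \<and>
    (v \<noteq> Full \<longrightarrow> (\<forall>i\<le>m. Comp C (Ya (fst f i) (\<beta> i)) (snd f i) \<in> Cp)) \<and>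
    (v = MinusMinusPlusPlus \<longrightarrow> strict_mono_on {..m} \<beta>)}"

lemma nmor_raise_mem_nmor_full:
  assumes C: "category C" and X: "nat_functor C (m, Xo, Xa)" and Y: "nat_functor C (n, Yo, Ya)"
    and f: "(\<alpha>, \<theta>) \<in> nmor_full C (m, Xo, Xa) (n, Yo, Ya)"
    and \<beta>: "\<beta> \<in> {..m} \<rightarrow>\<^sub>E {..n}" "\<forall>i\<le>m. \<alpha> i \<le> \<beta> i" "mono_on {..m} \<beta>"
  shows "nmor_raise C m Ya (\<alpha>, \<theta>) \<beta> \<in> nmor_full C (m, Xo, Xa) (n, Yo, Ya)"
proof -
  have \<theta>: "\<theta> i \<in> hom C (Xo i) (Yo (\<alpha> i))" if "i \<le> m" for i
    using f that by (simp add: nmor_full_def)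
  have \<beta>_le: "\<beta> i \<le> n" if "i \<le> m" for i
    using \<beta>(1) that by auto
  have \<beta>_mono: "\<beta> i \<le> \<beta> j" if "i \<le> j" "j \<le> m" for i j
    using \<beta>(3) that by (simp add: mono_onD)
  define \<phi> where "\<phi> i = Comp C (Ya (\<alpha> i) (\<beta> i)) (\<theta> i)" for i
  have \<phi>_hom: "\<phi> i \<in> hom C (Xo i) (Yo (\<beta> i))" if "i \<le> m" for i
    unfolding \<phi>_def using \<beta>(2) \<beta>_le \<theta> that by (blast intro: nat_functor_comp_hom[OF C Y])
  have \<phi>_natural: "Comp C (\<phi> j) (Xa i j) = Comp C (Ya (\<beta> i) (\<beta> j)) (\<phi> i)"
    if ij: "i \<le> j" "j \<le> m" for i j
  proof -
    have "Xa i j \<in> hom C (Xo i) (Xo j)" "Ya (\<alpha> j) (\<beta> j) \<in> hom C (Yo (\<alpha> j)) (Yo (\<beta> j))"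
      using ij \<beta>(2) \<beta>_le by (auto intro: nat_functor_hom[OF X] nat_functor_hom[OF Y])
    then have "Comp C (\<phi> j) (Xa i j) = Comp C (Ya (\<alpha> j) (\<beta> j)) (Comp C (\<theta> j) (Xa i j))"
      unfolding \<phi>_def using cat_comp_assoc[OF C _ \<theta>] ij by simp
    also have "Comp C (\<theta> j) (Xa i j) = Comp C (Ya (\<alpha> i) (\<alpha> j)) (\<theta> i)"
      using f ij by (simp add: nmor_full_def)
    also have "Comp C (Ya (\<alpha> j) (\<beta> j)) (Comp C (Ya (\<alpha> i) (\<alpha> j)) (\<theta> i)) =
        Comp C (Ya (\<alpha> i) (\<beta> j)) (\<theta> i)"
      using f ij \<beta>(2) \<beta>_le
      by (intro nat_functor_comp_comp[OF C Y _ _ _ \<theta>]) (auto simp: nmor_full_def)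
    also have "\<dots> = Comp C (Ya (\<beta> i) (\<beta> j)) (\<phi> i)"
      unfolding \<phi>_def using ij \<beta>(2) \<beta>_le \<beta>_mono
      by (intro nat_functor_comp_comp[OF C Y _ _ _ \<theta>, symmetric]) auto
    finally show ?thesis .
  qed
  show ?thesis
    using \<beta> \<beta>_le \<beta>_mono \<phi>_hom \<phi>_natural
    by (auto simp: nmor_full_def nmor_raise_def \<phi>_def PiE_def extensional_def)
qed

lemma upper_set_eq_nmor_raise_image:
  assumes C: "category C" and X: "nat_functor C (m, Xo, Xa)" and Y: "nat_functor C (n, Yo, Ya)"
    and f: "(\<alpha>, \<theta>) \<in> ghom v C Cm Cp (m, Xo, Xa) (n, Yo, Ya)"
  shows "{g \<in> ghom v C Cm Cp (m, Xo, Xa) (n, Yo, Ya). nmor_le C (m, Xo, Xa) (n, Yo, Ya) (\<alpha>, \<theta>) g} =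
    nmor_raise C m Ya (\<alpha>, \<theta>) ` raisings v C Cp m n Ya (\<alpha>, \<theta>)" (is "?U = ?I")
proof (intro equalityI subsetI)
  fix g assume "g \<in> ?U"
  moreover obtain \<beta> \<phi> where g: "g = (\<beta>, \<phi>)" by fastforce
  ultimately have full: "(\<beta>, \<phi>) \<in> nmor_full C (m, Xo, Xa) (n, Yo, Ya)"
    and \<phi>_Cp: "v \<noteq> Full \<longrightarrow> (\<forall>i\<le>m. \<phi> i \<in> Cp)"
    and inj: "v = MinusMinusPlusPlus \<longrightarrow> inj_on \<beta> {..m}"
    and le: "\<forall>i\<le>m. \<alpha> i \<le> \<beta> i \<and> \<phi> i = Comp C (Ya (\<alpha> i) (\<beta> i)) (\<theta> i)"
    by (auto simp: ghom_def nmor_le_def)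
  have mono: "mono_on {..m} \<beta>"
    using full by (auto intro: mono_onI simp: nmor_full_def)
  have "\<beta> \<in> raisings v C Cp m n Ya (\<alpha>, \<theta>)"
    using full \<phi>_Cp inj le mono
    by (auto simp: raisings_def nmor_full_def PiE_def extensional_def strict_mono_iff_mono)
  moreover have "g = nmor_raise C m Ya (\<alpha>, \<theta>) \<beta>"
    using full le by (auto simp: g nmor_raise_def nmor_full_def)
  ultimately show "g \<in> ?I"
    by blast
next
  fix g assume "g \<in> ?I"
  then obtain \<beta> where \<beta>: "\<beta> \<in> raisings v C Cp m n Ya (\<alpha>, \<theta>)"
    and g: "g = nmor_raise C m Ya (\<alpha>, \<theta>) \<beta>"
    by blast
  have "g \<in> nmor_full C (m, Xo, Xa) (n, Yo, Ya)"
    unfolding g using \<beta> f by (intro nmor_raise_mem_nmor_full[OF C X Y]) (auto simp: raisings_def ghom_def)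
  then show "g \<in> ?U"
    using \<beta> by (auto simp: g ghom_def nmor_le_def nmor_raise_def raisings_def strict_mono_on_imp_inj_on)
qed

lemma nmor_le_nmor_raise_iff:
  assumes C: "category C" and Y: "nat_functor C (n, Yo, Ya)"
    and \<theta>: "\<forall>i\<le>m. \<theta> i \<in> hom C (Xo i) (Yo (\<alpha> i))"
    and \<beta>: "\<beta> \<in> {..m} \<rightarrow>\<^sub>E {..n}" "\<forall>i\<le>m. \<alpha> i \<le> \<beta> i" and \<beta>': "\<beta>' \<in> {..m} \<rightarrow>\<^sub>E {..n}"
  shows "nmor_le C (m, Xo, Xa) (n, Yo, Ya) (nmor_raise C m Ya (\<alpha>, \<theta>) \<beta>) (nmor_raise C m Ya (\<alpha>, \<theta>) \<beta>')
    \<longleftrightarrow> \<beta> \<le> \<beta>'"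
proof -
  have "Comp C (Ya (\<beta> i) (\<beta>' i)) (Comp C (Ya (\<alpha> i) (\<beta> i)) (\<theta> i)) = Comp C (Ya (\<alpha> i) (\<beta>' i)) (\<theta> i)"
    if "i \<le> m" "\<beta> i \<le> \<beta>' i" for i
    using that \<theta> \<beta> \<beta>' by (intro nat_functor_comp_comp[OF C Y]) auto
  moreover have "\<beta> \<le> \<beta>' \<longleftrightarrow> (\<forall>i\<le>m. \<beta> i \<le> \<beta>' i)"
  proof
    assume "\<forall>i\<le>m. \<beta> i \<le> \<beta>' i"
    moreover have "\<beta> i = \<beta>' i" if "\<not> i \<le> m" for i
      using \<beta>(1) \<beta>' that by (simp add: PiE_def extensional_def)
    ultimately show "\<beta> \<le> \<beta>'"
      by (metis le_funI order_refl)
  qed (simp add: le_fun_def)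
  ultimately show ?thesis
    by (auto simp: nmor_le_def nmor_raise_def)
qed

lemma finite_raisings: "finite (raisings v C Cp m n Ya f)"
  by (rule finite_subset[of _ "{..m} \<rightarrow>\<^sub>E {..n}"]) (auto simp: raisings_def intro: finite_PiE)

lemma fst_mem_raisings:
  assumes C: "category C" and Y: "nat_functor C (n, Yo, Ya)"
    and f: "(\<alpha>, \<theta>) \<in> ghom v C Cm Cp (m, Xo, Xa) (n, Yo, Ya)"
  shows "\<alpha> \<in> raisings v C Cp m n Ya (\<alpha>, \<theta>)"
proof -
  have "Comp C (Ya (\<alpha> i) (\<alpha> i)) (\<theta> i) = \<theta> i" if "i \<le> m" for i
    using f that by (intro nat_functor_id_comp[OF C Y]) (auto simp: ghom_def nmor_full_def)
  moreover have "mono_on {..m} \<alpha>"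
    using f by (auto intro: mono_onI simp: ghom_def nmor_full_def)
  ultimately show ?thesis
    using f by (auto simp: raisings_def ghom_def nmor_full_def PiE_def extensional_def strict_mono_iff_mono)
qed

lemma raisings_pointwise_choice:
  assumes "\<beta> \<in> raisings v C Cp m n Ya f" "\<beta>' \<in> raisings v C Cp m n Ya f"
    and choice: "\<And>i. \<gamma> i = \<beta> i \<or> \<gamma> i = \<beta>' i"
    and "mono_on {..m} \<gamma>" "v = MinusMinusPlusPlus \<longrightarrow> strict_mono_on {..m} \<gamma>"
  shows "\<gamma> \<in> raisings v C Cp m n Ya f"
proof -
  have "\<gamma> i \<le> n \<and> fst f i \<le> \<gamma> i \<and> (v \<noteq> Full \<longrightarrow> Comp C (Ya (fst f i) (\<gamma> i)) (snd f i) \<in> Cp)"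
    if "i \<le> m" for i
    using choice[of i] assms(1,2) that by (elim disjE) (auto simp: raisings_def)
  moreover have "\<gamma> i = undefined" if "\<not> i \<le> m" for i
    using choice[of i] assms(1,2) that by (elim disjE) (auto simp: raisings_def PiE_def extensional_def)
  ultimately show ?thesis
    using assms(4,5) by (auto simp: raisings_def PiE_def extensional_def)
qed

lemma raisings_sup_closed:
  assumes "\<beta> \<in> raisings v C Cp m n Ya f" "\<beta>' \<in> raisings v C Cp m n Ya f"
  shows "sup \<beta> \<beta>' \<in> raisings v C Cp m n Ya f"
proof (rule raisings_pointwise_choice[OF assms])
  show "sup \<beta> \<beta>' i = \<beta> i \<or> sup \<beta> \<beta>' i = \<beta>' i" for i
    by (simp add: sup_nat_def max_def)
  show "mono_on {..m} (sup \<beta> \<beta>')"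
    using assms by (intro monotone_on_sup_fun) (simp_all add: raisings_def)
  show "v = MinusMinusPlusPlus \<longrightarrow> strict_mono_on {..m} (sup \<beta> \<beta>')"
    using assms strict_mono_on_max[of "{..m}" \<beta> \<beta>'] by (simp add: raisings_def sup_fun_def sup_nat_def)
qed

lemma raisings_inf_closed:
  assumes "\<beta> \<in> raisings v C Cp m n Ya f" "\<beta>' \<in> raisings v C Cp m n Ya f"
  shows "inf \<beta> \<beta>' \<in> raisings v C Cp m n Ya f"
proof (rule raisings_pointwise_choice[OF assms])
  show "inf \<beta> \<beta>' i = \<beta> i \<or> inf \<beta> \<beta>' i = \<beta>' i" for i
    by (simp add: inf_nat_def min_def)
  show "mono_on {..m} (inf \<beta> \<beta>')"
    using assms by (intro monotone_on_inf_fun) (simp_all add: raisings_def)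
  show "v = MinusMinusPlusPlus \<longrightarrow> strict_mono_on {..m} (inf \<beta> \<beta>')"
    using assms strict_mono_on_min[of "{..m}" \<beta> \<beta>'] by (simp add: raisings_def inf_fun_def inf_nat_def)
qed

theorem corollary4p5:
  fixes C :: "('o, 'm) cat" and Cm Cp :: "'m set" and v :: variant
    and x y :: "('o, 'm) nobj" and f :: "'m nmor"
  assumes "reedy C Cm Cp"
    and "gobj v C Cm Cp x" and "gobj v C Cm Cp y"
    and "f \<in> ghom v C Cm Cp x y"
  shows "bounded_distrib_lattice_on
           {g \<in> ghom v C Cm Cp x y. nmor_le C x y f g} (nmor_le C x y)"
proof -
  obtain m Xo Xa where x: "x = (m, Xo, Xa)" by (cases x) auto
  obtain n Yo Ya where y: "y = (n, Yo, Ya)" by (cases y) auto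
  obtain \<alpha> \<theta> where f: "f = (\<alpha>, \<theta>)" by fastforce
  have C: "category C" using assms(1) by (simp add: reedy_def)
  have X: "nat_functor C (m, Xo, Xa)" and Y: "nat_functor C (n, Yo, Ya)"
    using assms(2,3) by (simp_all add: x y gobj_def)
  have hom: "(\<alpha>, \<theta>) \<in> ghom v C Cm Cp (m, Xo, Xa) (n, Yo, Ya)"
    using assms(4) by (simp add: x y f)
  let ?R = "raisings v C Cp m n Ya (\<alpha>, \<theta>)"
  have "bounded_distrib_lattice_on ?R (\<le>)"
    using finite_raisings fst_mem_raisings[OF C Y hom] raisings_sup_closed raisings_inf_closed
    by (intro bounded_distrib_lattice_on_finite_sublattice) blast+
  then have "bounded_distrib_lattice_on (nmor_raise C m Ya (\<alpha>, \<theta>) ` ?R) (nmor_le C x y)"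
    using hom by (intro bounded_distrib_lattice_on_image)
      (auto simp: x y nmor_le_nmor_raise_iff[OF C Y] raisings_def ghom_def nmor_full_def)
  then show ?thesis
    using upper_set_eq_nmor_raise_image[OF C X Y hom] by (simp add: x y f)
qed

end
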